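(* Let $L\in\mathcal{F}^1$ be a convex-concave function with unique saddle point $z^*=(x^*,y^* )$ and let $F(x,y)=(\nabla_x L(x,y),-\nabla_y L(x,y))$. Assume there is a constant $M>0$ such that $$\langle F(z_1)-F(z_2),z_1-z_2\rangle\ge\frac1M\|F(z_1)-F(z_2)\|^2\qquad\text{for all } z_1,z_2\in\mathbb{R}^n\times\mathbb{R}^m .$$ Let $0<s\le 1/M$, let $z_0,\xi_0\in\mathbb{R}^n\times\mathbb{R}^m$, and let $\{z_k\}_{k\ge0}=\{(x_k,y_k)\}_{k\ge0}$ be generated by the explicit gradient descent-ascent scheme: for $k=1,2,\dots$, $$\xi_k=z_{k-1}-\frac{s}{2}F(z_{k-1}),\qquad z_k=z_{k-1}-\frac{s}{k+2}F(z_{k-1})+\frac{k-1}{k+2}(\xi_k-\xi_{k-1}).$$ Then for all $k\ge1$, $$L(x_k,y^* )-L(x^*,y_k)\le\frac{2\|z_0-z^*\|^2}{ks}.$$ Furthermore, $$\lim_{k\to\infty}k\,\bigl(L(x_k,y^* )-L(x^*,y_k)\bigr)=0.$$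
   Context: For $p\in\{1,2\}$, $\mathcal{F}^p$ denotes the class of $p$-times continuously differentiable functions $L:\mathbb{R}^n\times\mathbb{R}^m\to\mathbb{R}$, $(x,y)\mapsto L(x,y)$, that are convex in $x$ for each $y$ and concave in $y$ for each $x$, and that have a unique saddle point $z^*=(x^*,y^* )$, i.e. $L(x^*,y)\le L(x^*,y^* )\le L(x,y^* )$ for all $x,y$, where the left inequality is an equality if and only if $y=y^*$ and the right inequality is an equality if and only if $x=x^*$. Write $z=(x,y)$; $\|\cdot\|$ and $\langle\cdot,\cdot\rangle$ are the Euclidean norm and inner product. The value of $\xi_0$ is irrelevant, since its coefficient at $k=1$ is $0$. *)

theory Defs
  imports "HOL-Analysis.Analysis"
begin

definition gradient :: "('a::euclidean_space \<Rightarrow> real) \<Rightarrow> 'a \<Rightarrow> 'a"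
  where "gradient f x = (THE D. GDERIV f x :> D)"

primrec times_cont_differentiable :: "nat \<Rightarrow> ('a::euclidean_space \<Rightarrow> real) \<Rightarrow> bool"
  where
    "times_cont_differentiable 0 f \<longleftrightarrow> continuous_on UNIV f"
  | "times_cont_differentiable (Suc p) f \<longleftrightarrow>
       (\<exists>g. (\<forall>z. GDERIV f z :> g z) \<and>
            (\<forall>b\<in>Basis. times_cont_differentiable p (\<lambda>z. g z \<bullet> b)))"

text \<open>The two equality conditions make the saddle point strict, hence unique.\<close>

definition is_unique_saddle_point ::
  "((real ^ 'n) \<times> (real ^ 'm) \<Rightarrow> real) \<Rightarrow> real ^ 'n \<Rightarrow> real ^ 'm \<Rightarrow> bool"
  where "is_unique_saddle_point L xs ys \<longleftrightarrow>
    (\<forall>x y. L (xs, y) \<le> L (xs, ys) \<and> L (xs, ys) \<le> L (x, ys) \<and>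
           (L (xs, y) = L (xs, ys) \<longleftrightarrow> y = ys) \<and>
           (L (xs, ys) = L (x, ys) \<longleftrightarrow> x = xs))"

definition saddle_class :: "nat \<Rightarrow> ((real ^ 'n) \<times> (real ^ 'm) \<Rightarrow> real) set"
  where "saddle_class p = {L.
    times_cont_differentiable p L \<and>
    (\<forall>y. convex_on UNIV (\<lambda>x. L (x, y))) \<and>
    (\<forall>x. concave_on UNIV (\<lambda>y. L (x, y))) \<and>
    (\<exists>xs ys. is_unique_saddle_point L xs ys)}"

definition saddle_operator ::
  "((real ^ 'n) \<times> (real ^ 'm) \<Rightarrow> real) \<Rightarrow> (real ^ 'n) \<times> (real ^ 'm) \<Rightarrow> (real ^ 'n) \<times> (real ^ 'm)"
  where "saddle_operator L = (\<lambda>(x, y).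
    (gradient (\<lambda>u. L (u, y)) x, - gradient (\<lambda>v. L (x, v)) y))"

end

theory Submission
  imports Defs
begin

text \<open>
  Shift the saddle point to the origin and write \<open>v\<close> for the iterates, \<open>f\<close> for the values of \<open>F\<close>
  along them and \<open>d\<^sub>k = v\<^sub>k\<^sub>+\<^sub>1 - v\<^sub>k\<close>. Convexity-concavity bounds the gap by \<open>f\<^sub>k \<bullet> v\<^sub>k\<close>.
  By cocoercivity the energy
  \<open>\<parallel>2 v\<^sub>k + (k+3) d\<^sub>k\<parallel>\<^sup>2 / 4 + s (k+2) (f\<^sub>k \<bullet> v\<^sub>k) / 2 - s\<^sup>2 \<parallel>f\<^sub>k\<parallel>\<^sup>2 / 4\<close> does not increase; it starts at
  \<open>\<parallel>v\<^sub>0\<parallel>\<^sup>2\<close> and dominates \<open>s k (f\<^sub>k \<bullet> v\<^sub>k) / 2\<close>, which is the rate with its exact constant.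

  With \<open>p\<^sub>k = (k+3) d\<^sub>k + (s/2) (k+2) f\<^sub>k\<close>, also \<open>\<parallel>v\<^sub>k\<parallel>\<^sup>2 + \<parallel>v\<^sub>k + p\<^sub>k\<parallel>\<^sup>2\<close> does not increase. Together
  the two energies bound \<open>v\<^sub>k\<close>, \<open>p\<^sub>k\<close> and \<open>(k+3) d\<^sub>k\<close>, hence \<open>k \<parallel>f\<^sub>k\<parallel>\<close>. The gap is continuous,
  vanishes only at the saddle point, and tends to \<open>0\<close> along the bounded iterates, so \<open>v\<^sub>k\<close> tends to
  \<open>0\<close> by compactness, and \<open>k (f\<^sub>k \<bullet> v\<^sub>k) \<le> (k \<parallel>f\<^sub>k\<parallel>) \<parallel>v\<^sub>k\<parallel>\<close> gives the little-o rate.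
\<close>

section \<open>Polynomial identities behind the two energies\<close>

text \<open>\<open>p\<close> and \<open>q\<close> stand for \<open>p k\<close> and
  \<open>p (Suc k)\<close> of the iteration, both written through the same forward step
  \<open>d\<close>, and \<open>g\<close> for the increment of \<open>f\<close>. The right side is
  arranged so that each term is a cocoercivity defect or a square, with nonnegative weight once
  \<open>k\<close> and \<open>s\<close> are nonnegative.\<close>

lemma energy_dissipation:
  fixes v d f g :: "'a::real_inner" and k s :: real
  defines "p \<equiv> (k + 3) *\<^sub>R d + (s / 2 * (k + 2)) *\<^sub>R f"
    and "q \<equiv> (k + 1) *\<^sub>R (d + (s / 2) *\<^sub>R f)"
  shows "((norm (2 *\<^sub>R v + p))\<^sup>2 / 4 - s / 4 * (k + 2) * (p \<bullet> f)
            + s\<^sup>2 / 16 * (k\<^sup>2 + 4 * k) * (norm f)\<^sup>2)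
       - ((norm (2 *\<^sub>R (v + d) + q))\<^sup>2 / 4 - s / 4 * (k + 3) * (q \<bullet> (f + g))
            + s\<^sup>2 / 16 * ((k + 1)\<^sup>2 + 4 * (k + 1)) * (norm (f + g))\<^sup>2)
       = s / 4 * (k + 1) * (k + 3) * (g \<bullet> d - s * (norm g)\<^sup>2)
         + s / 2 * (f \<bullet> v - s * (norm f)\<^sup>2)
         + s\<^sup>2 / 16 * ((norm (2 *\<^sub>R f - (k + 1) *\<^sub>R g))\<^sup>2 + (2 * k\<^sup>2 + 8 * k + 6) * (norm g)\<^sup>2)"
  unfolding p_def q_def power2_norm_eq_inner
  by (simp add: inner_simps inner_commute[of d f] inner_commute[of g f] inner_commute[of g d]
      inner_commute[of v f] inner_commute[of v d] power2_eq_square field_simps)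

text \<open>A second quantity for the same step, meant to bound the position apart from the
  momentum. No increment of \<open>f\<close> enters, so cocoercivity against the saddle point alone
  gives the sign.\<close>

lemma aux_energy_dissipation:
  fixes v d f :: "'a::real_inner" and k s :: real
  defines "p \<equiv> (k + 3) *\<^sub>R d + (s / 2 * (k + 2)) *\<^sub>R f"
    and "q \<equiv> (k + 1) *\<^sub>R (d + (s / 2) *\<^sub>R f)"
  shows "((norm v)\<^sup>2 + (norm (v + p))\<^sup>2) - ((norm (v + d))\<^sup>2 + (norm (v + d + q))\<^sup>2)
       = (2 * k + 4) * (norm (d + (s / 2) *\<^sub>R f))\<^sup>2 + s * (f \<bullet> v - s / 4 * (norm f)\<^sup>2)"
  unfolding p_def q_def power2_norm_eq_inner
  by (simp add: inner_simps inner_commute[of d f] 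
      inner_commute[of v f] inner_commute[of v d] power2_eq_square field_simps)

text \<open>The left form is the one whose decrease can be computed; the right form shows the
  positivity from which bounds are read off.\<close>

lemma energy_complete_square:
  fixes v d f :: "'a::real_inner" and k s :: real
  defines "p \<equiv> (k + 3) *\<^sub>R d + (s / 2 * (k + 2)) *\<^sub>R f"
  shows "(norm (2 *\<^sub>R v + p))\<^sup>2 / 4 - s / 4 * (k + 2) * (p \<bullet> f)
            + s\<^sup>2 / 16 * (k\<^sup>2 + 4 * k) * (norm f)\<^sup>2
       = (norm (2 *\<^sub>R v + (k + 3) *\<^sub>R d))\<^sup>2 / 4 + s / 2 * (k + 2) * (f \<bullet> v) - s\<^sup>2 / 4 * (norm f)\<^sup>2"
  unfolding p_def power2_norm_eq_inner
  by (simp add: inner_simps inner_commute[of d f] 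
      inner_commute[of v f] inner_commute[of v d] power2_eq_square field_simps)

section \<open>Energy estimates for the abstract iteration\<close>

text \<open>\<open>step\<close> is the scheme with the auxiliary sequence eliminated and
  denominators cleared. Cocoercivity enters only between consecutive iterates and against the saddle
  point, placed at the origin.\<close>

locale accelerated_gda =
  fixes v f :: "nat \<Rightarrow> 'a::real_inner" and s :: real
  assumes s_pos: "s > 0"
    and step: "\<And>k. (real k + 3) *\<^sub>R (v (Suc k) - v k)
          = real k *\<^sub>R (v k - v (k - 1)) - s *\<^sub>R f k - (s / 2 * real k) *\<^sub>R (f k - f (k - 1))"
    and cocoercive_step: "\<And>k. s * (norm (f (Suc k) - f k))\<^sup>2 \<le> (f (Suc k) - f k) \<bullet> (v (Suc k) - v k)"
    and cocoercive_zero: "\<And>k. s * (norm (f k))\<^sup>2 \<le> f k \<bullet> v k"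
begin

text \<open>In \<open>p 0\<close> and in \<open>step\<close> the truncated index \<open>0 - 1\<close> is harmless: its coefficient vanishes.\<close>

definition p :: "nat \<Rightarrow> 'a"
  where "p k = real k *\<^sub>R (v k - v (k - 1)) + (s / 2 * real k) *\<^sub>R f (k - 1)"

definition energy :: "nat \<Rightarrow> real"
  where "energy k = (norm (2 *\<^sub>R v k + p k))\<^sup>2 / 4 - s / 4 * (real k + 2) * (p k \<bullet> f k)
            + s\<^sup>2 / 16 * ((real k)\<^sup>2 + 4 * real k) * (norm (f k))\<^sup>2"

definition aux_energy :: "nat \<Rightarrow> real"
  where "aux_energy k = (norm (v k))\<^sup>2 + (norm (v k + p k))\<^sup>2"

lemma p_0 [simp]: "p 0 = 0"
  by (simp add: p_def)

text \<open>The recursion trades the backward difference in \<open>p k\<close> for the forward one.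
  Together with \<open>p_Suc\<close>, this expresses two consecutive energies by the same
  step.\<close>

lemma p_eq: "p k = (real k + 3) *\<^sub>R (v (Suc k) - v k) + (s / 2 * (real k + 2)) *\<^sub>R f k"
  unfolding step p_def by (simp add: algebra_simps flip: scaleR_add_left)

lemma p_Suc: "p (Suc k) = (real k + 1) *\<^sub>R (v (Suc k) - v k + (s / 2) *\<^sub>R f k)"
  by (simp add: p_def algebra_simps)

lemma energy_Suc_le: "energy (Suc k) \<le> energy k"
proof -
  let ?d = "v (Suc k) - v k" and ?g = "f (Suc k) - f k" and ?k = "real k"
  have "energy k - energy (Suc k)
      = s / 4 * (?k + 1) * (?k + 3) * (?g \<bullet> ?d - s * (norm ?g)\<^sup>2)
         + s / 2 * (f k \<bullet> v k - s * (norm (f k))\<^sup>2)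
         + s\<^sup>2 / 16 * ((norm (2 *\<^sub>R f k - (?k + 1) *\<^sub>R ?g))\<^sup>2
             + (2 * ?k\<^sup>2 + 8 * ?k + 6) * (norm ?g)\<^sup>2)"
    unfolding energy_dissipation[of "v k" ?k ?d s "f k" ?g, symmetric]
    by (simp only: energy_def p_eq[of k] p_Suc) (simp add: add.commute)
  moreover have "\<dots> \<ge> 0"
    using s_pos cocoercive_step[of k] cocoercive_zero[of k]
    by (intro add_nonneg_nonneg mult_nonneg_nonneg) auto
  ultimately show ?thesis by linarith
qed

lemma energy_le: "energy k \<le> (norm (v 0))\<^sup>2"
proof (induction k)
  case 0
  show ?case by (simp add: energy_def power_mult_distrib)
next
  case (Suc k)
  then show ?case using energy_Suc_le[of k] by linarith
qed

lemma energy_eq: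
  "energy k = (norm (2 *\<^sub>R v k + (real k + 3) *\<^sub>R (v (Suc k) - v k)))\<^sup>2 / 4
              + s / 2 * (real k + 2) * (f k \<bullet> v k) - s\<^sup>2 / 4 * (norm (f k))\<^sup>2"
  unfolding energy_complete_square[symmetric] energy_def p_eq ..

lemma sq_norm_f_le: "s\<^sup>2 * (norm (f k))\<^sup>2 \<le> s * (f k \<bullet> v k)"
  using mult_left_mono[OF cocoercive_zero[of k], of s] s_pos
  by (simp add: power2_eq_square mult.assoc)

lemma inner_nonneg: "0 \<le> f k \<bullet> v k"
  using cocoercive_zero[of k] s_pos by (smt (verit) mult_nonneg_nonneg zero_le_power2)

lemma inner_le: "s * (real k * (f k \<bullet> v k)) \<le> 2 * (norm (v 0))\<^sup>2"
proof -
  \<comment> \<open>Of the weight \<open>k + 2\<close> in \<open>energy_eq\<close>, the part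
    \<open>k\<close> carries the rate and the remaining 2 absorbs the negative term in
    \<open>f k\<close>.\<close>
  have "s * (real k * (f k \<bullet> v k)) \<le> s * (real k * (f k \<bullet> v k)) + 2 * (s * (f k \<bullet> v k))
      - s\<^sup>2 / 2 * (norm (f k))\<^sup>2"
    using sq_norm_f_le[of k] mult_nonneg_nonneg[OF less_imp_le[OF s_pos] inner_nonneg[of k]]
    by simp
  also have "\<dots> \<le> 2 * energy k"
    by (simp add: energy_eq algebra_simps)
  finally show ?thesis using energy_le[of k] by linarith
qed

lemma momentum_le: "norm (2 *\<^sub>R v k + (real k + 3) *\<^sub>R (v (Suc k) - v k)) \<le> 2 * norm (v 0)"
proof (rule power2_le_imp_le)
  \<comment> \<open>Hence the square in \<open>energy_eq\<close> alone is at most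
    \<open>4 * energy k\<close>.\<close>
  have "s\<^sup>2 / 4 * (norm (f k))\<^sup>2 \<le> s / 2 * (real k + 2) * (f k \<bullet> v k)"
    using sq_norm_f_le[of k] mult_nonneg_nonneg[OF less_imp_le[OF s_pos] inner_nonneg[of k]]
      mult_nonneg_nonneg[OF of_nat_0_le_iff[of k] mult_nonneg_nonneg[OF less_imp_le[OF s_pos] inner_nonneg[of k]]]
    by (simp add: field_simps)
  then show "(norm (2 *\<^sub>R v k + (real k + 3) *\<^sub>R (v (Suc k) - v k)))\<^sup>2 \<le> (2 * norm (v 0))\<^sup>2"
    using energy_le[of k] unfolding energy_eq by (simp add: power_mult_distrib)
qed simp

lemma aux_energy_Suc_le: "aux_energy (Suc k) \<le> aux_energy k"
proof -
  let ?d = "v (Suc k) - v k" and ?k = "real k"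
  have "aux_energy k - aux_energy (Suc k)
      = (2 * ?k + 4) * (norm (?d + (s / 2) *\<^sub>R f k))\<^sup>2 + s * (f k \<bullet> v k - s / 4 * (norm (f k))\<^sup>2)"
    unfolding aux_energy_dissipation[of "v k" ?k ?d s "f k", symmetric]
    by (simp add: aux_energy_def p_eq[of k] p_Suc)
  moreover have "\<dots> \<ge> 0"
    using s_pos cocoercive_zero[of k] inner_nonneg[of k] by (intro add_nonneg_nonneg mult_nonneg_nonneg) auto
  ultimately show ?thesis by linarith
qed

lemma aux_energy_le: "aux_energy k \<le> (2 * norm (v 0))\<^sup>2"
proof (induction k)
  case 0
  \<comment> \<open>The initial value is \<open>2 * (norm (v 0))\<^sup>2\<close>; rounding it up to
    a perfect square avoids roots later.\<close>
  show ?case by (simp add: aux_energy_def power_mult_distrib)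
next
  case (Suc k)
  then show ?case using aux_energy_Suc_le[of k] by linarith
qed

lemma norm_v_le: "norm (v k) \<le> 2 * norm (v 0)"
proof (rule power2_le_imp_le)
  show "(norm (v k))\<^sup>2 \<le> (2 * norm (v 0))\<^sup>2"
    using aux_energy_le[of k] zero_le_power2[of "norm (v k + p k)"] unfolding aux_energy_def by linarith
qed simp

lemma norm_v_add_p_le: "norm (v k + p k) \<le> 2 * norm (v 0)"
proof (rule power2_le_imp_le)
  show "(norm (v k + p k))\<^sup>2 \<le> (2 * norm (v 0))\<^sup>2"
    using aux_energy_le[of k] zero_le_power2[of "norm (v k)"] unfolding aux_energy_def by linarith
qed simp

lemma norm_f_le: "s * (real k * norm (f k)) \<le> 12 * norm (v 0)"
proof -
  let ?w = "2 *\<^sub>R v k + (real k + 3) *\<^sub>R (v (Suc k) - v k)"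
  have "s / 2 * (real k + 2) * norm (f k) = norm ((s / 2 * (real k + 2)) *\<^sub>R f k)"
    using s_pos by simp
  \<comment> \<open>The momentum cancels between \<open>p k\<close> and \<open>?w\<close>. Each of
    the three vectors has norm at most \<open>2 * norm (v 0)\<close>, and doubling the sum gives the
    constant 12.\<close>
  also have "(s / 2 * (real k + 2)) *\<^sub>R f k = (v k + p k) + v k - ?w"
    unfolding p_eq by (simp add: scaleR_2)
  also have "norm \<dots> \<le> norm (v k + p k) + norm (v k) + norm ?w"
    by (meson add_right_mono norm_triangle_ineq norm_triangle_ineq4 order_trans)
  also have "\<dots> \<le> 6 * norm (v 0)"
    using norm_v_le[of k] norm_v_add_p_le[of k] momentum_le[of k] by linarith
  finally have "s * (real k * norm (f k)) + 2 * (s * norm (f k)) \<le> 12 * norm (v 0)"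
    by (simp add: algebra_simps)
  moreover have "0 \<le> s * norm (f k)"
    using s_pos by simp
  ultimately show ?thesis by linarith
qed

end

section \<open>Gradients, tangent inequalities and a compactness argument\<close>

lemma gradient_eqI:
  assumes D: "GDERIV f x :> D"
  shows "gradient f x = D"
proof -
  have "E = D" if "GDERIV f x :> E" for E
  proof -
    have "(\<lambda>h. h \<bullet> E) = (\<lambda>h. h \<bullet> D)"
      using that D unfolding gderiv_def by (rule has_derivative_unique)
    then have "(E - D) \<bullet> E = (E - D) \<bullet> D" by (rule fun_cong)
    then have "(E - D) \<bullet> (E - D) = 0" by (simp add: inner_diff_right)
    then show ?thesis by simp
  qed
  with D show ?thesis unfolding gradient_def by (intro the_equality)
qed

lemma GDERIV_Pair_left:
  assumes "GDERIV L (x, y) :> g"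
  shows "GDERIV (\<lambda>u. L (u, y)) x :> fst g"
proof -
  have "((\<lambda>u. L (u, y)) has_derivative (\<lambda>h. (h, 0) \<bullet> g)) (at x)"
    using assms unfolding gderiv_def
    by (rule has_derivative_compose[rotated]) (auto intro!: derivative_eq_intros)
  then show ?thesis by (simp add: gderiv_def inner_prod_def)
qed

lemma GDERIV_Pair_right:
  assumes "GDERIV L (x, y) :> g"
  shows "GDERIV (\<lambda>u. L (x, u)) y :> snd g"
proof -
  have "((\<lambda>u. L (x, u)) has_derivative (\<lambda>h. (0, h) \<bullet> g)) (at y)"
    using assms unfolding gderiv_def
    by (rule has_derivative_compose[rotated]) (auto intro!: derivative_eq_intros)
  then show ?thesis by (simp add: gderiv_def inner_prod_def)
qed

text \<open>Restriction to the line through \<open>x\<close> and \<open>y\<close> reduces this to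
  the one-dimensional tangent inequality, between parameters 0 and 1.\<close>

lemma convex_on_GDERIV_above_tangent:
  assumes "convex_on UNIV f" and "GDERIV f x :> D"
  shows "f x + (y - x) \<bullet> D \<le> f y"
proof -
  let ?l = "\<lambda>t. x + t *\<^sub>R (y - x)"
  have "convex_on UNIV (\<lambda>t. f (?l t))"
  proof (rule convex_onI)
    fix t a b :: real
    assume "0 < t" "t < 1"
    then have "f ((1 - t) *\<^sub>R ?l a + t *\<^sub>R ?l b) \<le> (1 - t) * f (?l a) + t * f (?l b)"
      using convex_onD[OF assms(1), of t "?l a" "?l b"] by simp
    also have "(1 - t) *\<^sub>R ?l a + t *\<^sub>R ?l b = ?l ((1 - t) *\<^sub>R a + t *\<^sub>R b)"
      by (simp add: algebra_simps)
    finally show "f (?l ((1 - t) *\<^sub>R a + t *\<^sub>R b)) \<le> (1 - t) * f (?l a) + t * f (?l b)" .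
  qed simp
  moreover have "((\<lambda>t. f (?l t)) has_derivative (\<lambda>h. (h *\<^sub>R (y - x)) \<bullet> D)) (at 0)"
    using assms(2) unfolding gderiv_def
    by (intro has_derivative_compose[where g = f and f = ?l]) (auto intro!: derivative_eq_intros)
  then have "((\<lambda>t. f (?l t)) has_field_derivative ((y - x) \<bullet> D)) (at 0)"
    by (simp add: has_field_derivative_def mult_commute_abs)
  ultimately show ?thesis
    using convex_on_imp_above_tangent[of UNIV "\<lambda>t. f (?l t)" 0 1 "(y - x) \<bullet> D"] by simp
qed

lemma GDERIV_global_min_eq_0:
  assumes "GDERIV f x :> D" and "\<And>y. f x \<le> f y"
  shows "D = 0"
proof -
  have "(\<lambda>h. h \<bullet> D) = (\<lambda>h. 0)"
    using assms unfolding gderiv_def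
    by (intro differential_zero_maxmin[where S = UNIV and f = f and x = x]) auto
  then have "D \<bullet> D = 0" by (rule fun_cong)
  then show ?thesis by simp
qed

text \<open>On the compact set of points of \<open>closure (range z)\<close> at distance at least
  \<open>e\<close> from \<open>a\<close>, \<open>h\<close> has a positive minimum, and the values
  \<open>h (z k)\<close> eventually drop below it.\<close>

lemma tendsto_unique_zero:
  fixes h :: "'a::heine_borel \<Rightarrow> real"
  assumes cont: "continuous_on UNIV h" and nonneg: "\<And>x. 0 \<le> h x" and zero: "\<And>x. h x = 0 \<Longrightarrow> x = a"
    and bdd: "bounded (range z)" and lim: "(\<lambda>k. h (z k)) \<longlonglongrightarrow> 0"
  shows "z \<longlonglongrightarrow> a"
proof (rule tendstoI)
  fix e :: real
  assume "0 < e"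
  define S where "S = closure (range z) - ball a e"
  have z_in: "z k \<in> closure (range z)" for k
    by (simp add: closure_subset[THEN subsetD])
  have "compact S"
    unfolding S_def using bdd by (intro compact_diff) auto
  show "\<forall>\<^sub>F k in sequentially. dist (z k) a < e"
  proof (cases "S = {}")
    case True
    then have "z k \<in> ball a e" for k
      using z_in[of k] unfolding S_def by blast
    then show ?thesis by (simp add: dist_commute)
  next
    case False
    then obtain m where m: "m \<in> S" "\<And>x. x \<in> S \<Longrightarrow> h m \<le> h x"
      using continuous_attains_inf[OF \<open>compact S\<close> False continuous_on_subset[OF cont subset_UNIV]]
      by auto
    have "m \<noteq> a"
      using m(1) \<open>0 < e\<close> by (auto simp: S_def)
    then have "0 < h m"
      using nonneg[of m] zero[of m] by fastforce
    then have "\<forall>\<^sub>F k in sequentially. h (z k) < h m"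
      using lim by (rule order_tendstoD[rotated])
    then show ?thesis
    proof eventually_elim
      case (elim k)
      then have "z k \<notin> S"
        using m(2)[of "z k"] by linarith
      then show ?case
        using z_in[of k] by (simp add: S_def dist_commute)
    qed
  qed
qed

section \<open>Application to the saddle problem\<close>

theorem theorem4p2:
  fixes L :: "(real ^ 'n) \<times> (real ^ 'm) \<Rightarrow> real"
    and F :: "(real ^ 'n) \<times> (real ^ 'm) \<Rightarrow> (real ^ 'n) \<times> (real ^ 'm)"
    and xstar :: "real ^ 'n" and ystar :: "real ^ 'm"
    and M s :: real
    and z \<xi> :: "nat \<Rightarrow> (real ^ 'n) \<times> (real ^ 'm)"
  assumes L: "L \<in> saddle_class 1"
    and saddle: "is_unique_saddle_point L xstar ystar"
    and F: "F = saddle_operator L"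
    and M: "M > 0"
    and cocoercive: "\<And>z1 z2. (F z1 - F z2) \<bullet> (z1 - z2) \<ge> (1 / M) * (norm (F z1 - F z2))\<^sup>2"
    and s: "0 < s" "s \<le> 1 / M"
    and \<xi>_step: "\<And>k. k \<ge> 1 \<Longrightarrow> \<xi> k = z (k - 1) - (s / 2) *\<^sub>R F (z (k - 1))"
    and z_step: "\<And>k. k \<ge> 1 \<Longrightarrow>
          z k = z (k - 1) - (s / (real k + 2)) *\<^sub>R F (z (k - 1))
                + ((real k - 1) / (real k + 2)) *\<^sub>R (\<xi> k - \<xi> (k - 1))"
  shows "(\<forall>k\<ge>1. L (fst (z k), ystar) - L (xstar, snd (z k))
                  \<le> 2 * (norm (z 0 - (xstar, ystar)))\<^sup>2 / (real k * s))
       \<and> (\<lambda>k. real k * (L (fst (z k), ystar) - L (xstar, snd (z k)))) \<longlonglongrightarrow> 0"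
proof -
  obtain g where g: "\<And>u. GDERIV L u :> g u"
    using L by (auto simp: saddle_class_def)
  have convex: "\<And>y. convex_on UNIV (\<lambda>x. L (x, y))" and concave: "\<And>x. concave_on UNIV (\<lambda>y. L (x, y))"
    using L by (auto simp: saddle_class_def)
  have gx: "GDERIV (\<lambda>u. L (u, y)) x :> fst (g (x, y))" and gy: "GDERIV (\<lambda>u. L (x, u)) y :> snd (g (x, y))"
    for x y
    using GDERIV_Pair_left[OF g] GDERIV_Pair_right[OF g] by auto
  have F_eq: "F (x, y) = (fst (g (x, y)), - snd (g (x, y)))" for x y
    unfolding F saddle_operator_def using gradient_eqI[OF gx] gradient_eqI[OF gy] by simp
  have saddle_le: "L (xstar, y) \<le> L (xstar, ystar)" "L (xstar, ystar) \<le> L (x, ystar)"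
    and saddle_eq: "L (xstar, y) = L (xstar, ystar) \<Longrightarrow> y = ystar"
      "L (xstar, ystar) = L (x, ystar) \<Longrightarrow> x = xstar" for x y
    using saddle unfolding is_unique_saddle_point_def by blast+
  define zs where "zs = (xstar, ystar)"
  define gap where "gap u = L (fst u, ystar) - L (xstar, snd u)" for u
  have gap_nonneg: "0 \<le> gap u" for u
    using saddle_le(1)[of "snd u"] saddle_le(2)[of "fst u"] by (simp add: gap_def)
  have gap_zero: "u = zs" if "gap u = 0" for u
  proof -
    have "L (xstar, snd u) = L (xstar, ystar)" "L (xstar, ystar) = L (fst u, ystar)"
      using that saddle_le(1)[of "snd u"] saddle_le(2)[of "fst u"] unfolding gap_def by linarith+
    then show ?thesis
      using saddle_eq by (simp add: zs_def prod_eq_iff)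
  qed
  have gap_le: "gap u \<le> F u \<bullet> (u - zs)" for u
  proof -
    obtain x y where u: "u = (x, y)" by fastforce
    \<comment> \<open>Tangent inequalities at \<open>u\<close> for \<open>L\<close> in the first
      variable and \<open>- L\<close> in the second; in their sum \<open>L (x, y)\<close>
      cancels.\<close>
    have "L (x, y) + (xstar - x) \<bullet> fst (g (x, y)) \<le> L (xstar, y)"
      by (rule convex_on_GDERIV_above_tangent[OF convex gx])
    moreover have "- L (x, y) + (ystar - y) \<bullet> - snd (g (x, y)) \<le> - L (x, ystar)"
      using convex_on_GDERIV_above_tangent[OF _ GDERIV_minus[OF gy]] concave
      unfolding concave_on_def by blast
    ultimately show ?thesis
      by (simp add: u gap_def zs_def F_eq inner_prod_def inner_diff_left inner_diff_right inner_commute)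
  qed
  \<comment> \<open>The saddle point is a zero of \<open>F\<close>, which turns cocoercivity against
    \<open>zs\<close> into \<open>cocoercive_zero\<close>.\<close>
  have "fst (g zs) = 0"
    unfolding zs_def by (rule GDERIV_global_min_eq_0[OF gx]) (rule saddle_le)
  moreover have "- snd (g zs) = 0"
    unfolding zs_def by (rule GDERIV_global_min_eq_0[OF GDERIV_minus[OF gy]]) (simp add: saddle_le)
  ultimately have F_zs: "F zs = 0"
    by (simp add: zs_def F_eq zero_prod_def)
  have cocoercive_s: "s * (norm (F z1 - F z2))\<^sup>2 \<le> (F z1 - F z2) \<bullet> (z1 - z2)" for z1 z2
    using cocoercive[of z1 z2] mult_right_mono[OF s(2), of "(norm (F z1 - F z2))\<^sup>2"] by simp

  define v where "v k = z k - zs" for k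
  define f where "f k = F (z k)" for k
  interpret accelerated_gda v f s
  proof
    show "0 < s" by (rule s)
    show "s * (norm (f (Suc k) - f k))\<^sup>2 \<le> (f (Suc k) - f k) \<bullet> (v (Suc k) - v k)" for k
      using cocoercive_s[of "z (Suc k)" "z k"] by (simp add: v_def f_def)
    show "s * (norm (f k))\<^sup>2 \<le> f k \<bullet> v k" for k
      using cocoercive_s[of "z k" zs] by (simp add: v_def f_def F_zs)
    fix k
    \<comment> \<open>The scheme is read at index \<open>Suc k\<close>, so its denominator is
      \<open>k + 3\<close> and its momentum numerator is \<open>k\<close>.\<close>
    have "(real k + 3) *\<^sub>R (v (Suc k) - v k)
        = - s *\<^sub>R f k + real k *\<^sub>R (\<xi> (Suc k) - \<xi> k)"
      using z_step[of "Suc k"]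
      by (simp add: v_def f_def add.commute scaleR_add_right scaleR_diff_right)
    \<comment> \<open>At \<open>k = 0\<close> the arbitrary \<open>\<xi> 0\<close> is multiplied by
      0; for positive \<open>k\<close> the scheme determines both terms.\<close>
    also have "real k *\<^sub>R (\<xi> (Suc k) - \<xi> k)
        = real k *\<^sub>R (v k - v (k - 1)) - (s / 2 * real k) *\<^sub>R (f k - f (k - 1))"
    proof (cases "k = 0")
      case False
      then have "\<xi> (Suc k) - \<xi> k = (v k - v (k - 1)) - (s / 2) *\<^sub>R (f k - f (k - 1))"
        by (simp add: \<xi>_step v_def f_def scaleR_diff_right)
      then show ?thesis by (simp add: scaleR_diff_right mult.commute)
    qed simp
    finally show "(real k + 3) *\<^sub>R (v (Suc k) - v k)
          = real k *\<^sub>R (v k - v (k - 1)) - s *\<^sub>R f k - (s / 2 * real k) *\<^sub>R (f k - f (k - 1))"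
      by simp
  qed

  have gap_bound: "s * (real k * gap (z k)) \<le> 2 * (norm (v 0))\<^sup>2" for k
  proof -
    have "s * (real k * gap (z k)) \<le> s * (real k * (f k \<bullet> v k))"
      using gap_le[of "z k"] s(1) by (intro mult_left_mono) (auto simp: f_def v_def)
    then show ?thesis using inner_le[of k] by linarith
  qed
  then have rate: "gap (z k) \<le> 2 * (norm (v 0))\<^sup>2 / (real k * s)" if "k \<ge> 1" for k
    using that s(1) by (simp add: pos_le_divide_eq ac_simps)

  \<comment> \<open>The rate forces the gap itself to 0, which identifies the limit of the iterates;
    the decay of \<open>norm (v k)\<close> then upgrades the rate.\<close>
  have "(\<lambda>k. gap (z k)) \<longlonglongrightarrow> 0"
  proof (rule tendsto_sandwich[of "\<lambda>_. 0" _ _ "\<lambda>k. 2 * (norm (v 0))\<^sup>2 / (real k * s)"])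
    show "\<forall>\<^sub>F k in sequentially. gap (z k) \<le> 2 * (norm (v 0))\<^sup>2 / (real k * s)"
      using eventually_ge_at_top[of 1] by eventually_elim (rule rate)
    show "(\<lambda>k. 2 * (norm (v 0))\<^sup>2 / (real k * s)) \<longlonglongrightarrow> 0"
      using tendsto_mult[OF tendsto_const[of "2 * (norm (v 0))\<^sup>2 / s"] lim_1_over_n]
      by (simp add: field_simps)
  qed (simp_all add: gap_nonneg)
  moreover have "bounded (range z)"
  proof -
    have "norm (z k) \<le> 2 * norm (v 0) + norm zs" for k
      using norm_v_le[of k] norm_triangle_ineq[of "v k" zs] by (simp add: v_def)
    then show ?thesis by (auto simp: bounded_iff)
  qed
  moreover have "continuous_on UNIV L"
    using g unfolding gderiv_def by (intro has_derivative_continuous_on) simp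
  then have L_compose: "continuous_on UNIV (\<lambda>u. L (h u))" if "continuous_on UNIV h"
    for h :: "(real ^ 'n) \<times> (real ^ 'm) \<Rightarrow> _"
    by (rule continuous_on_compose2[OF _ that subset_UNIV])
  have "continuous_on UNIV gap"
    unfolding gap_def by (intro continuous_on_diff L_compose continuous_intros)
  ultimately have "z \<longlonglongrightarrow> zs"
    using gap_nonneg gap_zero by (intro tendsto_unique_zero[of gap]) auto
  then have "(\<lambda>k. norm (v k)) \<longlonglongrightarrow> 0"
    unfolding v_def by (intro tendsto_norm_zero) (simp add: LIM_zero)
  then have lim: "(\<lambda>k. 12 * norm (v 0) / s * norm (v k)) \<longlonglongrightarrow> 0"
    by (rule tendsto_mult_right_zero)
  have "real k * gap (z k) \<le> 12 * norm (v 0) / s * norm (v k)" for k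
  proof -
    have "real k * gap (z k) \<le> real k * (norm (f k) * norm (v k))"
      using gap_le[of "z k"] norm_cauchy_schwarz[of "f k" "v k"]
      by (intro mult_left_mono) (auto simp: f_def v_def)
    also have "\<dots> \<le> 12 * norm (v 0) / s * norm (v k)"
      using norm_f_le[of k] s(1)
      by (subst mult.assoc[symmetric], intro mult_right_mono) (auto simp: field_simps)
    finally show ?thesis .
  qed
  then have "(\<lambda>k. real k * gap (z k)) \<longlonglongrightarrow> 0"
    using lim gap_nonneg by (intro tendsto_sandwich[OF _ _ tendsto_const lim]) auto
  then show ?thesis
    using rate by (simp add: gap_def v_def zs_def)
qed

end
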